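(* Let $S=\{x_1,x_2,\dots,x_n\}$ be any set of $n$ distinct positive integers, let $m>0$ be a real number, and let $f(x)=x^{-m}$ for all positive integers $x$. Then (a) $[S^{\ast\ast}]_f$ is positive definite; (b) $(S^{\ast\ast})_f$ is indefinite for $n\ge 2$.
   Context: A positive divisor $d$ of a positive integer $n$ is a unitary divisor of $n$, written $d\parallel n$, if $\gcd(d,n/d)=1$. For positive integers $a,b$, $(a,b)^{\ast\ast}$ denotes the greatest common unitary divisor of $a$ and $b$ (the largest $d$ with $d\parallel a$ and $d\parallel b$), and $[a,b]^{\ast\ast}=ab/(a,b)^{\ast\ast}$ is the pseudo-LCUM (pseudo least common unitary multiple). $(S^{\ast\ast})_f$ is the $n\times n$ matrix with $ij$ entry $f((x_i,x_j)^{\ast\ast})$, and $[S^{\ast\ast}]_f$ is the $n\times n$ matrix with $ij$ entry $f([x_i,x_j]^{\ast\ast})$. A real symmetric matrix is indefinite if it is neither positive semidefinite nor negative semidefinite. *)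

theory Defs
  imports "HOL-Analysis.Analysis"
begin

definition unitary_dvd :: "nat \<Rightarrow> nat \<Rightarrow> bool" (infix "\<parallel>\<parallel>" 50)
  where "d \<parallel>\<parallel> n \<longleftrightarrow> d dvd n \<and> coprime d (n div d)"

(* For positive a and b the set below is finite and contains 1. *)
definition gcud :: "nat \<Rightarrow> nat \<Rightarrow> nat"
  where "gcud a b = Max {d. d \<parallel>\<parallel> a \<and> d \<parallel>\<parallel> b}"

(* The division is exact, since gcud a b divides a. *)
definition pseudo_lcum :: "nat \<Rightarrow> nat \<Rightarrow> nat"
  where "pseudo_lcum a b = a * b div gcud a b"

(* The set S = {x_1, ..., x_n} is given by an injective enumeration x on a finite index type
   with n elements. *)
definition gcud_matrix :: "(nat \<Rightarrow> real) \<Rightarrow> ('n::finite \<Rightarrow> nat) \<Rightarrow> real^'n^'n"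
  where "gcud_matrix f x = (\<chi> i j. f (gcud (x i) (x j)))"

definition pseudo_lcum_matrix :: "(nat \<Rightarrow> real) \<Rightarrow> ('n::finite \<Rightarrow> nat) \<Rightarrow> real^'n^'n"
  where "pseudo_lcum_matrix f x = (\<chi> i j. f (pseudo_lcum (x i) (x j)))"

definition symmetric_matrix :: "real^'n^'n \<Rightarrow> bool"
  where "symmetric_matrix A \<longleftrightarrow> transpose A = A"

definition positive_definite :: "real^'n^'n \<Rightarrow> bool"
  where "positive_definite A \<longleftrightarrow> symmetric_matrix A \<and> (\<forall>v. v \<noteq> 0 \<longrightarrow> v \<bullet> (A *v v) > 0)"

definition positive_semidefinite :: "real^'n^'n \<Rightarrow> bool"
  where "positive_semidefinite A \<longleftrightarrow> symmetric_matrix A \<and> (\<forall>v. v \<bullet> (A *v v) \<ge> 0)"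

definition negative_semidefinite :: "real^'n^'n \<Rightarrow> bool"
  where "negative_semidefinite A \<longleftrightarrow> symmetric_matrix A \<and> (\<forall>v. v \<bullet> (A *v v) \<le> 0)"

definition indefinite :: "real^'n^'n \<Rightarrow> bool"
  where "indefinite A \<longleftrightarrow>
    symmetric_matrix A \<and> \<not> positive_semidefinite A \<and> \<not> negative_semidefinite A"

end

theory Submission
  imports Defs
begin

text \<open>
  Identify a positive integer \<open>n\<close> with the finite set of its prime-power components, that is, the
  pairs \<open>(p, k)\<close> with \<open>p\<close> prime, \<open>k > 0\<close> and \<open>p ^ k\<close> exactly dividing \<open>n\<close>. Unitary divisibility is
  then inclusion of sets, the greatest common unitary divisor is intersection
  (\<open>gcud_eq_prod_common_components\<close>), and its \<open>m\<close>-th power is a product of weights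
  \<open>p ^ (k * m) > 1\<close> over an intersection. Writing each weight as \<open>1 + (weight - 1)\<close> and expanding
  the product over all subsets exhibits the quadratic form of such a kernel as a sum of squares with
  positive coefficients, and a triangularity argument shows that these squares do not vanish together
  (\<open>intersection_kernel_pos\<close>). So the matrix with entries \<open>gcud ^ m\<close> is positive definite.

  The pseudo-LCUM of \<open>a\<close> and \<open>b\<close> being \<open>a * b\<close> divided by \<open>gcud a b\<close>, the matrix of part (a)
  arises from that one by scaling row and column \<open>i\<close> by \<open>x i powr - m\<close>, which preserves positive
  definiteness.

  For part (b), the diagonal entries of the GCUD matrix are positive. Since \<open>gcud a b\<close> is at
  most \<open>a\<close> and \<open>b\<close>, and smaller than one of them if \<open>a \<noteq> b\<close>, the two corresponding diagonal entries
  add up to less than twice the off-diagonal one; so the form is negative on a difference of two unit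
  vectors.
\<close>

section \<open>Prime-power components and unitary divisors\<close>

definition prime_components :: "nat \<Rightarrow> (nat \<times> nat) set" where
  "prime_components n = (\<lambda>p. (p, multiplicity p n)) ` prime_factors n"

lemma finite_prime_components [simp]: "finite (prime_components n)"
  by (simp add: prime_components_def)

lemma prod_prime_components:
  assumes "n > 0"
  shows "(\<Prod>(p, k)\<in>prime_components n. p ^ k) = n"
proof -
  have "(\<Prod>(p, k)\<in>prime_components n. p ^ k) = (\<Prod>p\<in>prime_factors n. p ^ multiplicity p n)"
    unfolding prime_components_def by (subst prod.reindex) (auto simp: inj_on_def)
  then show ?thesis
    using assms by (simp add: prime_factorization_nat[symmetric])
qed

lemma inj_on_prime_components: "inj_on prime_components {0<..}"
  by (rule inj_on_inverseI[where g = "\<lambda>T. \<Prod>(p, k)\<in>T. p ^ k"]) (simp add: prod_prime_components)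

lemma prime_component_gt_one:
  assumes "(p, k) \<in> prime_components n"
  shows "p ^ k > 1"
proof -
  have "prime p" "k > 0"
    using assms by (auto simp: prime_components_def prime_factors_multiplicity)
  then show ?thesis
    by (intro one_less_power prime_gt_1_nat)
qed

lemma prod_subset_prime_components_pos:
  assumes "T \<subseteq> prime_components n"
  shows "(\<Prod>(p, k)\<in>T. p ^ k) > 0"
proof (rule prod_pos)
  fix t assume "t \<in> T"
  then have "fst t ^ snd t > 1"
    using assms by (intro prime_component_gt_one[of _ _ n]) auto
  then show "0 < (case t of (p, k) \<Rightarrow> p ^ k)"
    unfolding case_prod_unfold by linarith
qed

text \<open>
  If \<open>n = d * e\<close>, then multiplicities in \<open>d\<close> and \<open>e\<close> add up to those in \<open>n\<close>. So \<open>d\<close> and \<open>e\<close>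
  share no prime exactly when every prime of \<open>d\<close> already has its full multiplicity there.
\<close>

lemma unitary_dvd_iff_prime_components:
  assumes "d > 0" "n > 0"
  shows "d \<parallel>\<parallel> n \<longleftrightarrow> prime_components d \<subseteq> prime_components n"
proof
  assume "d \<parallel>\<parallel> n"
  then have dvd: "d dvd n" and cop: "coprime d (n div d)"
    by (auto simp: unitary_dvd_def)
  define e where "e = n div d"
  have n: "n = d * e" and "e > 0"
    using dvd assms by (auto simp: e_def)
  have "multiplicity p n = multiplicity p d" if p: "p \<in> prime_factors d" for p
  proof -
    have "\<not> p dvd e"
      using p cop unfolding e_def
      by (metis coprime_common_divisor in_prime_factors_iff not_prime_unit)
    then show ?thesis
      using p assms \<open>e > 0\<close>
      by (simp add: n prime_elem_multiplicity_mult_distrib in_prime_factors_iff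
          not_dvd_imp_multiplicity_0)
  qed
  moreover have "prime_factors d \<subseteq> prime_factors n"
    using dvd assms by (simp add: dvd_prime_factors)
  ultimately show "prime_components d \<subseteq> prime_components n"
    unfolding prime_components_def by force
next
  assume sub: "prime_components d \<subseteq> prime_components n"
  then have eq: "multiplicity p d = multiplicity p n" if "p \<in> prime_factors d" for p
    using that unfolding prime_components_def by auto
  have dvd: "d dvd n"
  proof (rule multiplicity_le_imp_dvd)
    fix p :: nat assume "prime p"
    then show "multiplicity p d \<le> multiplicity p n"
      using eq[of p] by (cases "p \<in> prime_factors d") (auto simp: prime_factors_multiplicity)
  qed (use assms in auto)
  define e where "e = n div d"
  have n: "n = d * e" and "e > 0"
    using dvd assms by (auto simp: e_def)
  have "coprime d e"
  proof (rule ccontr)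
    assume "\<not> coprime d e"
    then have "gcd d e \<noteq> 1"
      by (simp add: coprime_iff_gcd_eq_1)
    then obtain p where "prime p" "p dvd gcd d e"
      using prime_factor_nat by blast
    then have p: "prime p" "p dvd d" "p dvd e"
      by auto
    then have "multiplicity p e > 0"
      using \<open>e > 0\<close> by (simp add: prime_multiplicity_gt_zero_iff)
    moreover have "multiplicity p n = multiplicity p d + multiplicity p e"
      using p assms \<open>e > 0\<close> by (simp add: n prime_elem_multiplicity_mult_distrib)
    moreover have "multiplicity p d = multiplicity p n"
      using p assms by (intro eq) (auto simp: in_prime_factors_iff)
    ultimately show False
      by simp
  qed
  then show "d \<parallel>\<parallel> n"
    using dvd by (simp add: unitary_dvd_def e_def)
qed

text \<open>
  Every subset of the components is realised by a number. This makes the intersection of two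
  component sets the component set of a common unitary divisor.
\<close>

lemma prime_components_prod:
  assumes "T \<subseteq> prime_components n"
  shows "prime_components (\<Prod>(p, k)\<in>T. p ^ k) = T"
proof -
  obtain S where S: "S \<subseteq> prime_factors n" and T: "T = (\<lambda>p. (p, multiplicity p n)) ` S"
    using assms unfolding prime_components_def by (auto elim!: subset_imageE)
  have fin: "finite S"
    using S finite_subset by blast
  define D where "D = (\<Prod>p\<in>S. p ^ multiplicity p n)"
  have D: "(\<Prod>(p, k)\<in>T. p ^ k) = D"
    unfolding T D_def by (subst prod.reindex) (auto simp: inj_on_def)
  have mult: "multiplicity p D = (if p \<in> S then multiplicity p n else 0)" if "prime p" for p
    unfolding D_def using S fin that by (intro multiplicity_prod_prime_powers) auto
  have "prime_factors D = S"
    using S mult by (auto simp: prime_factors_multiplicity split: if_splits)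
  moreover have "multiplicity p D = multiplicity p n" if "p \<in> S" for p
    using S mult that by (auto simp: in_prime_factors_iff)
  ultimately have "prime_components D = T"
    unfolding prime_components_def T by (simp cong: image_cong)
  then show ?thesis
    by (simp only: D)
qed

lemma gcud_eq_prod_common_components:
  assumes "a > 0" "b > 0"
  shows "gcud a b = (\<Prod>(p, k)\<in>prime_components a \<inter> prime_components b. p ^ k)"
proof -
  define T where "T = prime_components a \<inter> prime_components b"
  define D where "D = (\<Prod>(p, k)\<in>T. p ^ k)"
  have comp: "prime_components D = T"
    unfolding D_def by (rule prime_components_prod[of _ a]) (simp add: T_def)
  have D_pos: "D > 0"
    unfolding D_def T_def by (rule prod_subset_prime_components_pos[of _ a]) simp
  have "Max {d. d \<parallel>\<parallel> a \<and> d \<parallel>\<parallel> b} = D"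
  proof (rule Max_eqI)
    show "finite {d. d \<parallel>\<parallel> a \<and> d \<parallel>\<parallel> b}"
      by (rule finite_subset[of _ "{..a}"]) (use assms in \<open>auto simp: unitary_dvd_def dvd_imp_le\<close>)
    show "D \<in> {d. d \<parallel>\<parallel> a \<and> d \<parallel>\<parallel> b}"
      using assms D_pos by (simp add: unitary_dvd_iff_prime_components comp T_def)
  next
    fix d assume "d \<in> {d. d \<parallel>\<parallel> a \<and> d \<parallel>\<parallel> b}"
    then have d: "d \<parallel>\<parallel> a" "d \<parallel>\<parallel> b" by auto
    then have "d > 0"
      using assms by (auto simp: unitary_dvd_def intro: Nat.gr0I)
    then have "prime_components d \<subseteq> prime_components D"
      using d assms by (simp add: unitary_dvd_iff_prime_components comp T_def)
    then have "d dvd D"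
      using \<open>d > 0\<close> D_pos by (simp add: unitary_dvd_def flip: unitary_dvd_iff_prime_components)
    then show "d \<le> D"
      using D_pos by (rule dvd_imp_le)
  qed
  then show ?thesis
    by (simp add: gcud_def D_def T_def)
qed

lemma gcud_pos:
  assumes "a > 0" "b > 0"
  shows "gcud a b > 0"
  unfolding gcud_eq_prod_common_components[OF assms]
  by (rule prod_subset_prime_components_pos[of _ a]) simp

lemma gcud_dvd:
  assumes "a > 0" "b > 0"
  shows "gcud a b dvd a" "gcud a b dvd b"
proof -
  have "prime_components (gcud a b) = prime_components a \<inter> prime_components b"
    unfolding gcud_eq_prod_common_components[OF assms]
    by (rule prime_components_prod[of _ a]) simp
  then have "gcud a b \<parallel>\<parallel> a" "gcud a b \<parallel>\<parallel> b"
    using assms by (simp_all add: unitary_dvd_iff_prime_components gcud_pos)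
  then show "gcud a b dvd a" "gcud a b dvd b"
    by (simp_all add: unitary_dvd_def)
qed

lemma gcud_commute: "gcud a b = gcud b a"
  by (simp add: gcud_def conj_commute)

lemma gcud_self: "a > 0 \<Longrightarrow> gcud a a = a"
  by (simp add: gcud_eq_prod_common_components prod_prime_components)

lemma gcud_powr:
  assumes "a > 0" "b > 0"
  shows "real (gcud a b) powr m =
    (\<Prod>(p, k)\<in>prime_components a \<inter> prime_components b. real (p ^ k) powr m)"
proof -
  have "real (gcud a b) = (\<Prod>t\<in>prime_components a \<inter> prime_components b. real (fst t ^ snd t))"
    by (simp add: gcud_eq_prod_common_components[OF assms] case_prod_unfold)
  then show ?thesis
    by (simp add: case_prod_unfold prod_powr_distrib)
qed

lemma pseudo_lcum_powr:
  assumes "a > 0" "b > 0"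
  shows "real (pseudo_lcum a b) powr (- m) =
    real a powr (- m) * real b powr (- m) * real (gcud a b) powr m"
proof -
  have "real (pseudo_lcum a b) = real a * real b / real (gcud a b)"
    using gcud_dvd(1)[OF assms] by (simp add: pseudo_lcum_def real_of_nat_div)
  then show ?thesis
    by (simp add: powr_divide powr_mult powr_minus field_simps)
qed

section \<open>Kernels given by products over intersections\<close>

text \<open>
  Expanding the product writes the kernel as a sum of the positive numbers
  \<open>c T = (\<Prod>t\<in>T. w t - 1)\<close> over all \<open>T\<close> contained in both sets, so the form is the sum of
  \<open>c T * (z T)\<^sup>2\<close>, where \<open>z T\<close> adds up the \<open>y i\<close> with \<open>T \<subseteq> Q i\<close>. If \<open>Q i\<close> is as large as possible
  among the indices with \<open>y i \<noteq> 0\<close>, then injectivity leaves only one summand in \<open>z (Q i)\<close>,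
  and so \<open>z (Q i) = y i \<noteq> 0\<close>.
\<close>

lemma intersection_kernel_pos:
  fixes Q :: "'n::finite \<Rightarrow> 'a set" and w :: "'a \<Rightarrow> real" and y :: "'n \<Rightarrow> real"
  assumes fin: "\<And>i. finite (Q i)" and inj: "inj Q"
    and w: "\<And>i t. t \<in> Q i \<Longrightarrow> w t > 1"
    and nonzero: "\<exists>i. y i \<noteq> 0"
  shows "(\<Sum>i\<in>UNIV. \<Sum>j\<in>UNIV. y i * y j * (\<Prod>t\<in>Q i \<inter> Q j. w t)) > 0"
proof -
  define U where "U = (\<Union>i. Q i)"
  define c where "c T = (\<Prod>t\<in>T. w t - 1)" for T
  define z where "z T = (\<Sum>i\<in>UNIV. if T \<subseteq> Q i then y i else 0)" for T
  have finU: "finite U"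
    by (simp add: U_def fin)
  have c_pos: "c T > 0" if "T \<subseteq> U" for T
    unfolding c_def using that w by (intro prod_pos) (fastforce simp: U_def)
  have kernel: "(\<Prod>t\<in>Q i \<inter> Q j. w t) =
      (\<Sum>T\<in>Pow U. c T * ((if T \<subseteq> Q i then 1 else 0) * (if T \<subseteq> Q j then 1 else 0)))" for i j
  proof -
    have "(\<Prod>t\<in>Q i \<inter> Q j. w t) = (\<Prod>t\<in>Q i \<inter> Q j. (w t - 1) + 1)"
      by simp
    also have "\<dots> = (\<Sum>T\<in>Pow (Q i \<inter> Q j). c T)"
      unfolding c_def by (subst prod_add) (simp_all add: fin)
    also have "\<dots> = (\<Sum>T\<in>Pow U. c T * ((if T \<subseteq> Q i then 1 else 0) * (if T \<subseteq> Q j then 1 else 0)))"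
      by (intro sum.mono_neutral_cong_left) (use finU in \<open>auto simp: U_def\<close>)
    finally show ?thesis .
  qed
  have z: "z T = (\<Sum>i\<in>UNIV. y i * (if T \<subseteq> Q i then 1 else 0))" for T
    unfolding z_def by (intro sum.cong) auto
  have "(\<Sum>i\<in>UNIV. \<Sum>j\<in>UNIV. y i * y j * (\<Prod>t\<in>Q i \<inter> Q j. w t)) =
      (\<Sum>i\<in>UNIV. \<Sum>j\<in>UNIV. \<Sum>T\<in>Pow U.
        c T * ((y i * (if T \<subseteq> Q i then 1 else 0)) * (y j * (if T \<subseteq> Q j then 1 else 0))))"
    unfolding kernel sum_distrib_left by (intro sum.cong refl) (simp only: mult_ac)
  also have "\<dots> = (\<Sum>i\<in>UNIV. \<Sum>T\<in>Pow U. \<Sum>j\<in>UNIV.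
        c T * ((y i * (if T \<subseteq> Q i then 1 else 0)) * (y j * (if T \<subseteq> Q j then 1 else 0))))"
    by (intro sum.cong refl sum.swap)
  also have "\<dots> = (\<Sum>T\<in>Pow U. \<Sum>i\<in>UNIV. \<Sum>j\<in>UNIV.
        c T * ((y i * (if T \<subseteq> Q i then 1 else 0)) * (y j * (if T \<subseteq> Q j then 1 else 0))))"
    by (rule sum.swap)
  also have "\<dots> = (\<Sum>T\<in>Pow U. c T * (z T)\<^sup>2)"
    unfolding z power2_eq_square sum_product by (simp only: sum_distrib_left)
  also have "\<dots> > 0"
  proof -
    obtain i where i: "y i \<noteq> 0" and max: "\<And>j. y j \<noteq> 0 \<Longrightarrow> card (Q j) \<le> card (Q i)"
    proof -
      have ne: "{i. y i \<noteq> 0} \<noteq> {}" using nonzero by auto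
      have "Max ((\<lambda>i. card (Q i)) ` {i. y i \<noteq> 0}) \<in> (\<lambda>i. card (Q i)) ` {i. y i \<noteq> 0}"
        using ne by (intro Max_in) auto
      then obtain i where "y i \<noteq> 0" "card (Q i) = Max ((\<lambda>i. card (Q i)) ` {i. y i \<noteq> 0})"
        by auto
      then show ?thesis
        by (intro that[of i]) auto
    qed
    have "(if Q i \<subseteq> Q j then y j else 0) = 0" if "j \<noteq> i" for j
    proof (rule ccontr)
      assume "(if Q i \<subseteq> Q j then y j else 0) \<noteq> 0"
      then have "Q i \<subseteq> Q j" "y j \<noteq> 0"
        by (auto split: if_splits)
      then have "Q i = Q j"
        using max fin card_seteq by blast
      then show False
        using inj that by (auto dest: injD)
    qed
    then have "z (Q i) = (\<Sum>j\<in>{i}. if Q i \<subseteq> Q j then y j else 0)"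
      unfolding z_def by (intro sum.mono_neutral_right) auto
    then have "(z (Q i))\<^sup>2 > 0"
      using i by simp
    moreover have "Q i \<subseteq> U"
      by (auto simp: U_def)
    ultimately show ?thesis
      using finU c_pos
      by (intro sum_pos2[of _ "Q i"]) (auto intro!: mult_nonneg_nonneg simp: less_imp_le)
  qed
  finally show ?thesis .
qed

section \<open>The two matrices\<close>

lemma quadratic_form_eq_sum:
  fixes A :: "real^'n::finite^'n"
  shows "v \<bullet> (A *v v) = (\<Sum>i\<in>UNIV. \<Sum>j\<in>UNIV. v $ i * v $ j * A $ i $ j)"
  by (simp add: inner_vec_def matrix_vector_mult_def sum_distrib_left mult_ac)

lemma positive_definite_pseudo_lcum_matrix:
  fixes x :: "'n::finite \<Rightarrow> nat"
  assumes inj: "inj x" and pos: "\<And>i. x i > 0" and m: "m > 0"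
    and f: "\<And>k. k > 0 \<Longrightarrow> f k = real k powr (- m)"
  shows "positive_definite (pseudo_lcum_matrix f x)"
  unfolding positive_definite_def
proof (intro conjI allI impI)
  show "symmetric_matrix (pseudo_lcum_matrix f x)"
    by (simp add: symmetric_matrix_def transpose_def pseudo_lcum_matrix_def pseudo_lcum_def
        gcud_commute mult.commute)
next
  fix v :: "real^'n" assume "v \<noteq> 0"
  define w :: "nat \<times> nat \<Rightarrow> real" where "w = (\<lambda>(p, k). real (p ^ k) powr m)"
  define Q where "Q i = prime_components (x i)" for i
  define y where "y i = v $ i * real (x i) powr (- m)" for i
  have entry: "pseudo_lcum_matrix f x $ i $ j =
      real (x i) powr (- m) * real (x j) powr (- m) * (\<Prod>t\<in>Q i \<inter> Q j. w t)" for i j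
  proof -
    have "pseudo_lcum (x i) (x j) > 0"
      unfolding pseudo_lcum_def using pos gcud_dvd(1)[OF pos[of i] pos[of j]]
      by (simp add: gcud_pos div_greater_zero_iff dvd_imp_le)
    then show ?thesis
      by (simp add: pseudo_lcum_matrix_def f pseudo_lcum_powr gcud_powr pos w_def Q_def)
  qed
  have "v \<bullet> (pseudo_lcum_matrix f x *v v) =
      (\<Sum>i\<in>UNIV. \<Sum>j\<in>UNIV. y i * y j * (\<Prod>t\<in>Q i \<inter> Q j. w t))"
    by (simp add: quadratic_form_eq_sum entry y_def mult_ac)
  also have "\<dots> > 0"
  proof (rule intersection_kernel_pos)
    show "finite (Q i)" for i
      by (simp add: Q_def)
    show "inj Q"
      using inj pos inj_on_prime_components unfolding Q_def inj_on_def by auto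
    show "w t > 1" if "t \<in> Q i" for i t
    proof -
      have "real (fst t ^ snd t) > 1"
        using that prime_component_gt_one[of "fst t" "snd t"] unfolding Q_def
        by (metis of_nat_1 of_nat_less_iff prod.collapse)
      then show ?thesis
        using m unfolding w_def case_prod_unfold by (rule gr_one_powr)
    qed
    show "\<exists>i. y i \<noteq> 0"
      using \<open>v \<noteq> 0\<close> pos by (auto simp: y_def vec_eq_iff)
  qed
  finally show "v \<bullet> (pseudo_lcum_matrix f x *v v) > 0" .
qed

lemma indefinite_gcud_matrix:
  fixes x :: "'n::finite \<Rightarrow> nat"
  assumes inj: "inj x" and pos: "\<And>i. x i > 0" and m: "m > 0"
    and f: "\<And>k. k > 0 \<Longrightarrow> f k = real k powr (- m)"
    and card: "CARD('n) \<ge> 2"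
  shows "indefinite (gcud_matrix f x)"
proof -
  let ?A = "gcud_matrix f x"
  have sym: "symmetric_matrix ?A"
    by (simp add: symmetric_matrix_def transpose_def gcud_matrix_def gcud_commute)
  have entry: "?A $ i $ j = real (gcud (x i) (x j)) powr (- m)" for i j
    by (simp add: gcud_matrix_def f gcud_pos pos)
  have axis: "axis i 1 \<bullet> (?A *v axis j 1) = ?A $ i $ j" for i j
    by (simp add: matrix_vector_mul_component inner_axis inner_axis' matrix_vector_mult_basis column_def)
  obtain a b :: 'n where "a \<noteq> b"
    using card by (metis card_le_Suc0_iff_eq finite UNIV_I not_less_eq_eq numeral_2_eq_2)
  then obtain i j where less: "x i < x j"
    using inj by (metis injD linorder_neqE_nat)
  have "axis i 1 \<bullet> (?A *v axis i 1) > 0"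
    using pos by (simp add: axis entry gcud_self)
  then have not_neg: "\<not> negative_semidefinite ?A"
    unfolding negative_semidefinite_def by (meson not_le)
  let ?g = "gcud (x i) (x j)"
  have g: "?g > 0" "?g \<le> x i"
    using pos gcud_dvd(1)[of "x i" "x j"] by (auto simp: gcud_pos dvd_imp_le)
  \<comment> \<open>Strictness comes from entry \<open>j\<close> alone, since \<open>?g\<close> may equal \<open>x i\<close>.\<close>
  have "(axis i 1 - axis j 1) \<bullet> (?A *v (axis i 1 - axis j 1)) =
      ?A $ i $ i + ?A $ j $ j - ?A $ i $ j - ?A $ j $ i"
    by (simp add: matrix_vector_mult_diff_distrib inner_diff_left inner_diff_right axis)
  also have "\<dots> = real (x i) powr (- m) + real (x j) powr (- m) - 2 * real ?g powr (- m)"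
    using gcud_commute[of "x j" "x i"] by (simp add: entry gcud_self pos)
  also have "\<dots> < 0"
  proof -
    have "real (x i) powr (- m) \<le> real ?g powr (- m)"
      using g m by (intro powr_mono2') auto
    moreover have "real (x j) powr (- m) < real ?g powr (- m)"
      using g m less by (intro powr_less_mono2_neg) auto
    ultimately show ?thesis
      by simp
  qed
  finally have "\<not> positive_semidefinite ?A"
    unfolding positive_semidefinite_def by (meson not_le)
  with sym not_neg show ?thesis
    by (simp add: indefinite_def)
qed

theorem theorem5p8:
  fixes x :: "'n::finite \<Rightarrow> nat" and m :: real and f :: "nat \<Rightarrow> real"
  assumes "inj x"
    and "\<And>i. x i > 0"
    and "m > 0"
    and "\<And>k. k > 0 \<Longrightarrow> f k = real k powr (- m)"
  shows "positive_definite (pseudo_lcum_matrix f x) \<and>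
    (CARD('n) \<ge> 2 \<longrightarrow> indefinite (gcud_matrix f x))"
  using positive_definite_pseudo_lcum_matrix[of x m f] indefinite_gcud_matrix[of x m f] assms
  by blast

end
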